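(* Let a random variable $X$ have probability mass function $p_X(j)=p_j$, $j\in\mathbb{N}_0$, and let $Y=a^X$, $a>1$. If $$p_j=o\left(a^{-j(j-1)/2}\right)\quad\text{as } j\to+\infty,$$ then there are no perturbation functions for the probability mass function $p_Y$ of $Y$.
   Context: $\mathbb{N}_0=\{0,1,2,\dots\}$. For a random variable with a discrete distribution whose probability mass function $p$ is given by $p(x_j)=p_j$, $j\in\mathbb{N}_0$, a sequence $h=\{h_j\}_{j\in\mathbb{N}_0}$ is a perturbation (perturbation function) for $p$ if $\sup_j|h_j|=1$ and $\sum_{j=0}^\infty x_j^k p_jh_j=0$ for all $k\in\mathbb{N}_0$. For $Y=a^X$ one has $x_j=a^j$ and $p_Y(a^j)=p_j$, so the latter condition reads $\sum_{j=0}^\infty a^{kj}p_jh_j=0$ for all $k\in\mathbb{N}_0$.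
   Formalization: In the definition of perturbation, sup|h_j|=1 is taken only over j with p_j>0 instead of all j; otherwise, if some p_j=0, the indicator of that j would be a perturbation and the claim would fail. If all p_j>0 nothing changes. *)

theory Defs
  imports "HOL-Probability.Probability" "HOL-Library.Landau_Symbols"
begin

definition prob_mass :: "'a measure \<Rightarrow> ('a \<Rightarrow> 'b) \<Rightarrow> 'b \<Rightarrow> real" where
  "prob_mass M Z z = measure M {\<omega> \<in> space M. Z \<omega> = z}"

(* h is a perturbation function for the probability mass function q carried by the points
   x 0, x 1, ..., with q (x j) playing the role of p_j.  The supremum runs over the indices of
   actual atoms, i.e. h counts as a function on the support of q: at a point of mass 0 the value
   of h is not constrained by the moment equations, so with the supremum over all indices the
   indicator of a null point would be a perturbation.  When all masses are positive this is the
   supremum over all indices (perturbation_iff_of_pos).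
   Boundedness is explicit because the SUP of an unbounded set of reals is unspecified. *)
definition perturbation :: "(real \<Rightarrow> real) \<Rightarrow> (nat \<Rightarrow> real) \<Rightarrow> (nat \<Rightarrow> real) \<Rightarrow> bool" where
  "perturbation q x h \<longleftrightarrow>
     bdd_above ((\<lambda>j. \<bar>h j\<bar>) ` {j. q (x j) > 0}) \<and>
     (SUP j\<in>{j. q (x j) > 0}. \<bar>h j\<bar>) = 1 \<and>
     (\<forall>k::nat. (\<lambda>j. x j ^ k * q (x j) * h j) sums 0)"

lemma perturbation_iff_of_pos:
  assumes "\<And>j. q (x j) > 0"
  shows "perturbation q x h \<longleftrightarrow>
     bdd_above (range (\<lambda>j. \<bar>h j\<bar>)) \<and> (SUP j. \<bar>h j\<bar>) = 1 \<and>
     (\<forall>k::nat. (\<lambda>j. x j ^ k * q (x j) * h j) sums 0)"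
  using assms by (simp add: perturbation_def)

end

theory Submission
  imports Defs
begin

text \<open>
  Write \<open>c j = p j * h j\<close>. A perturbation \<open>h\<close> makes \<open>c\<close> orthogonal to every power of \<open>a ^ j\<close>, hence
  to every polynomial in \<open>a ^ j\<close>, and \<open>c\<close> inherits the decay of \<open>p\<close> because \<open>\<bar>h\<bar> \<le> 1\<close> on the
  support of \<open>p\<close>. It suffices that such a \<open>c\<close> vanishes identically
  (\<open>zero_if_small_and_orthogonal_to_powers\<close>): then \<open>h = 0\<close> on the support of \<open>p\<close>, whereas its
  supremum there is \<open>1\<close>.

  To isolate \<open>c m\<close>, test against the polynomial
  \<open>P\<^sub>n(x) = \<Prod>i<n, i \<noteq> m. (1 - x / a ^ i)\<close>, which kills every index below \<open>n\<close> except \<open>m\<close>. Let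
  \<open>n\<close> tend to infinity.
  \<^item> The values \<open>P\<^sub>n(a ^ m)\<close> stay away from \<open>0\<close>, since the infinite product
    \<open>\<Prod>i\<noteq>m. (1 - a ^ m / a ^ i)\<close> converges to a nonzero limit (\<open>node_product_limit\<close>).
  \<^item> For \<open>r \<ge> 0\<close> the growth of \<open>P\<^sub>n(a ^ (n + r))\<close> is exactly compensated by the weight
    \<open>a ^ (-j(j-1)/2)\<close> at \<open>j = n + r\<close>: their product is at most \<open>a ^ (m - r(r+1)/2)\<close>, uniformly in \<open>n\<close>
    (\<open>node_poly_tail_bound\<close>). So a sequence that is little-o of this weight has a tail
    \<open>\<Sum>j\<ge>n. c j * P\<^sub>n(a ^ j)\<close> tending to \<open>0\<close>.
  As \<open>c m * P\<^sub>n(a ^ m)\<close> and the tail cancel, \<open>c m = 0\<close>.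
\<close>

text \<open>The Lagrange-type polynomial for the node \<open>a ^ m\<close> among \<open>1, a, \<dots>, a ^ (n - 1)\<close>, with each
  factor normalised to constant term \<open>1\<close> so that the values at \<open>a ^ m\<close> converge as \<open>n\<close> grows.\<close>

definition node_poly :: "real \<Rightarrow> nat \<Rightarrow> nat \<Rightarrow> real poly" where
  "node_poly a m n = (\<Prod>i<n. if i = m then 1 else [:1, - 1 / a ^ i:])"

lemma poly_node_poly:
  "poly (node_poly a m n) x = (\<Prod>i<n. if i = m then 1 else 1 - x / a ^ i)"
  unfolding node_poly_def poly_prod by (intro prod.cong) auto

lemma node_poly_eq_0:
  assumes "a > 1" "j < n" "j \<noteq> m"
  shows "poly (node_poly a m n) (a ^ j) = 0"
  using assms by (auto simp: poly_node_poly intro!: bexI[of _ j])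

text \<open>A factor \<open>1 - a ^ m / a ^ i\<close> vanishes only for \<open>i = m\<close>, which is left out, and differs from
  \<open>1\<close> by a geometric sequence in \<open>i\<close>; an infinite product of this kind has a nonzero value.\<close>

lemma node_product_limit:
  assumes "a > 1"
  obtains L where "L \<noteq> 0" "(\<lambda>n. poly (node_poly a m n) (a ^ m)) \<longlonglongrightarrow> L"
proof -
  define u where "u = (\<lambda>i. if i = m then 1 else 1 - a ^ m / a ^ i)"
  have "summable (\<lambda>i. a ^ m * (1 / a) ^ i)"
    using assms by (intro summable_mult summable_geometric) auto
  then have "summable (\<lambda>i. norm (u i - 1))"
    by (rule summable_comparison_test[rotated])
       (use assms in \<open>auto simp: u_def power_divide\<close>)
  then have conv: "convergent_prod u"
    by (intro abs_convergent_prod_imp_convergent_prod)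
       (simp add: abs_convergent_prod_conv_summable)
  have nz: "u i \<noteq> 0" for i
    using assms by (auto simp: u_def)
  have "(\<lambda>n. \<Prod>i\<le>n. u i) \<longlonglongrightarrow> prodinf u"
    by (rule convergent_prod_LIMSEQ[OF conv])
  then have "(\<lambda>n. \<Prod>i<n. u i) \<longlonglongrightarrow> prodinf u"
    by (simp add: LIMSEQ_lessThan_iff_atMost)
  then have "(\<lambda>n. poly (node_poly a m n) (a ^ m)) \<longlonglongrightarrow> prodinf u"
    by (simp add: poly_node_poly u_def)
  moreover have "prodinf u \<noteq> 0"
    using prodinf_nonzero[OF conv nz] .
  ultimately show ?thesis using that by blast
qed

text \<open>Each factor at \<open>a ^ j\<close> with \<open>j \<ge> n\<close> is at most \<open>a ^ (j - i)\<close> in absolute value. The exponents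
  add up to \<open>n j - n(n-1)/2 - (j - m)\<close>; subtracting \<open>j(j-1)/2\<close> at \<open>j = n + r\<close> cancels all
  dependence on \<open>n\<close> and leaves \<open>m - r(r+1)/2\<close>, which is at most \<open>m - r\<close>. The cruder linear exponent
  makes the bound a geometric sequence in \<open>r\<close>.\<close>

lemma node_poly_tail_bound:
  fixes a :: real and n m r :: nat
  assumes a: "a > 1" and m: "m < n" and j: "j = n + r"
  shows "\<bar>poly (node_poly a m n) (a ^ j)\<bar> * a powr (- (real j * (real j - 1) / 2))
           \<le> a ^ m * (1 / a) ^ r"
proof -
  define e where "e = (\<lambda>i. if i = m then 0 else real j - real i)"
  have "\<bar>poly (node_poly a m n) (a ^ j)\<bar> = (\<Prod>i<n. \<bar>if i = m then 1 else 1 - a ^ j / a ^ i\<bar>)"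
    unfolding poly_node_poly abs_prod ..
  also have "\<dots> \<le> (\<Prod>i<n. a powr e i)"
  proof (intro prod_mono conjI)
    fix i assume i: "i \<in> {..<n}"
    have "a powr (real j - real i) = a ^ j / a ^ i"
      using a by (simp add: powr_diff powr_realpow)
    moreover have "a ^ i \<le> a ^ j"
      using a i by (intro power_increasing) (auto simp: j)
    then have "1 \<le> a ^ j / a ^ i"
      using a by simp
    ultimately show "\<bar>if i = m then 1 else 1 - a ^ j / a ^ i\<bar> \<le> a powr e i"
      using a by (auto simp: e_def)
  qed auto
  also have "\<dots> = a powr (\<Sum>i<n. e i)"
    using a by (simp add: powr_sum)
  finally have P: "\<bar>poly (node_poly a m n) (a ^ j)\<bar> \<le> a powr (\<Sum>i<n. e i)" .

  have gauss: "(\<Sum>i<k. real j - real i) = real k * real j - real k * (real k - 1) / 2" for k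
    by (induction k) (auto simp: field_simps)
  have "(\<Sum>i<n. e i) = (\<Sum>i\<in>{..<n} - {m}. real j - real i)"
    using m by (intro sum.mono_neutral_cong_right) (auto simp: e_def)
  also have "\<dots> = (\<Sum>i<n. real j - real i) - (real j - real m)"
    using m by (subst sum_diff1) auto
  finally have e: "(\<Sum>i<n. e i) = real n * real j - real n * (real n - 1) / 2 - (real j - real m)"
    by (simp add: gauss)

  have "real r \<le> real r * real r"
    by (cases r) auto
  then have exponent: "(\<Sum>i<n. e i) - real j * (real j - 1) / 2 \<le> real m - real r"
    unfolding e j by (simp add: field_simps)

  have "\<bar>poly (node_poly a m n) (a ^ j)\<bar> * a powr (- (real j * (real j - 1) / 2))
          \<le> a powr (\<Sum>i<n. e i) * a powr (- (real j * (real j - 1) / 2))"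
    by (intro mult_right_mono P) auto
  also have "\<dots> = a powr ((\<Sum>i<n. e i) - real j * (real j - 1) / 2)"
    by (simp flip: powr_add)
  also have "\<dots> \<le> a powr (real m - real r)"
    using a exponent by (intro powr_mono) auto
  also have "\<dots> = a ^ m * (1 / a) ^ r"
    using a by (simp add: powr_diff powr_realpow power_divide)
  finally show ?thesis .
qed

lemma sums_poly_zero:
  fixes x c :: "nat \<Rightarrow> 'a :: real_normed_field"
  assumes "\<And>k. (\<lambda>j. x j ^ k * c j) sums 0"
  shows "(\<lambda>j. poly P (x j) * c j) sums 0"
proof -
  have "(\<lambda>j. \<Sum>k\<le>degree P. coeff P k * (x j ^ k * c j)) sums (\<Sum>k\<le>degree P. coeff P k * 0)"
    by (intro sums_sum sums_mult assms)
  then show ?thesis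
    by (simp add: poly_altdef sum_distrib_right mult.assoc)
qed

text \<open>The little-o rate is sharp: the alternating sum \<open>\<Sum>j. (-1) ^ j * a ^ (k j) * w j\<close> vanishes for
  all \<open>k\<close> for a suitable positive \<open>w\<close> of order \<open>a ^ (-j(j-1)/2)\<close> (Euler's expansion of
  \<open>\<Prod>i. (1 - x / a ^ i)\<close>), so the hypothesis has to force the tail of the test sum to \<open>0\<close> and
  not merely to be bounded.\<close>

lemma zero_if_small_and_orthogonal_to_powers:
  fixes a :: real and c :: "nat \<Rightarrow> real"
  assumes a: "a > 1"
    and small: "c \<in> o(\<lambda>j. a powr (- (real j * (real j - 1) / 2)))"
    and orth: "\<And>k. (\<lambda>j. (a ^ j) ^ k * c j) sums 0"
  shows "c m = 0"
proof -
  define F where "F = (\<lambda>n. poly (node_poly a m n) (a ^ m))"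
  define C where "C = a ^ m * (1 / (1 - 1 / a))"
  have C: "C > 0"
    using a by (simp add: C_def)
  have bound: "\<forall>\<^sub>F n in sequentially. \<bar>c m * F n\<bar> \<le> \<epsilon> * C" if \<epsilon>: "\<epsilon> > 0" for \<epsilon>
  proof -
    obtain N where N: "\<bar>c j\<bar> \<le> \<epsilon> * a powr (- (real j * (real j - 1) / 2))" if "j \<ge> N" for j
      using landau_o.smallD[OF small \<epsilon>] by (auto simp: eventually_sequentially)
    have "\<bar>c m * F n\<bar> \<le> \<epsilon> * C" if n: "n \<ge> max N (Suc m)" for n
    proof -
      define t where "t = (\<lambda>j. poly (node_poly a m n) (a ^ j) * c j)"
      have "t sums 0"
        unfolding t_def by (intro sums_poly_zero orth)
      then have tail: "(\<lambda>r. t (r + n)) sums (- (\<Sum>j<n. t j))"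
        using sums_split_initial_segment[of t 0 n] by simp
      have "(\<Sum>j<n. t j) = (\<Sum>j\<in>{m}. t j)"
        using n a by (intro sum.mono_neutral_right) (auto simp: t_def node_poly_eq_0)
      then have head: "(\<Sum>j<n. t j) = c m * F n"
        by (simp add: t_def F_def)
      have termwise: "norm (t (r + n)) \<le> \<epsilon> * (a ^ m * (1 / a) ^ r)" for r
      proof -
        define j where "j = n + r"
        have "\<bar>t j\<bar> \<le> \<bar>poly (node_poly a m n) (a ^ j)\<bar>
                        * (\<epsilon> * a powr (- (real j * (real j - 1) / 2)))"
          unfolding t_def abs_mult using n by (intro mult_left_mono N) (auto simp: j_def)
        also have "\<dots> = \<epsilon> * (\<bar>poly (node_poly a m n) (a ^ j)\<bar>
                        * a powr (- (real j * (real j - 1) / 2)))"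
          by simp
        also have "\<dots> \<le> \<epsilon> * (a ^ m * (1 / a) ^ r)"
          using n \<epsilon> a by (intro mult_left_mono node_poly_tail_bound) (auto simp: j_def)
        finally show ?thesis
          by (simp add: j_def add.commute)
      qed
      have "(\<lambda>r. \<epsilon> * (a ^ m * (1 / a) ^ r)) sums (\<epsilon> * C)"
        unfolding C_def using a by (intro sums_mult geometric_sums) auto
      from norm_sums_le[OF tail this termwise] show ?thesis
        by (simp add: head)
    qed
    then show ?thesis
      unfolding eventually_sequentially by blast
  qed
  have "(\<lambda>n. c m * F n) \<longlonglongrightarrow> 0"
  proof (rule tendstoI)
    fix e :: real assume "e > 0"
    then have "\<forall>\<^sub>F n in sequentially. \<bar>c m * F n\<bar> \<le> e / (2 * C) * C"
      using C by (intro bound) auto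
    then show "\<forall>\<^sub>F n in sequentially. dist (c m * F n) 0 < e"
      by eventually_elim (use C \<open>e > 0\<close> in auto)
  qed
  moreover obtain L where L: "L \<noteq> 0" "F \<longlonglongrightarrow> L"
    unfolding F_def using node_product_limit[OF a] by blast
  then have "(\<lambda>n. c m * F n) \<longlonglongrightarrow> c m * L"
    by (intro tendsto_mult tendsto_const)
  ultimately have "c m * L = 0"
    using LIMSEQ_unique by blast
  then show "c m = 0"
    using L by simp
qed

text \<open>Needed because the supremum in \<open>perturbation\<close> runs over the support: over an empty index set
  its value would be unspecified, and no contradiction with \<open>1\<close> could be drawn.\<close>

lemma (in prob_space) prob_mass_pos_ex:
  fixes X :: "'a \<Rightarrow> nat"
  assumes X: "X \<in> measurable M (count_space UNIV)"
  shows "\<exists>j. prob_mass M X j > 0"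
proof (rule ccontr)
  assume no: "\<not> ?thesis"
  have "prob {\<omega> \<in> space M. X \<omega> = j} = 0" for j
    using no measure_nonneg[of M "{\<omega> \<in> space M. X \<omega> = j}"]
    unfolding prob_mass_def by (meson not_less order_antisym)
  moreover have "{\<omega> \<in> space M. X \<omega> = j} \<in> events" for j
    using X by measurable
  ultimately have "AE \<omega> in M. \<forall>j. \<omega> \<notin> {\<omega> \<in> space M. X \<omega> = j}"
    unfolding AE_all_countable by (intro allI AE_not_in) (auto simp: null_sets_def emeasure_eq_measure)
  then have "AE \<omega> in M. False"
    using AE_space by eventually_elim auto
  then show False
    by simp
qed

theorem theorem2p3:
  fixes M :: "'a measure" and X :: "'a \<Rightarrow> nat" and Y :: "'a \<Rightarrow> real"
    and p :: "nat \<Rightarrow> real" and a :: real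
  assumes "prob_space M"
    and "X \<in> measurable M (count_space UNIV)"
    and "\<And>j. prob_mass M X j = p j"
    and "a > 1"
    and "\<And>\<omega>. \<omega> \<in> space M \<Longrightarrow> Y \<omega> = a ^ X \<omega>"
    and "p \<in> o(\<lambda>j. a powr (- (real j * (real j - 1) / 2)))"
  shows "\<not> (\<exists>h. perturbation (prob_mass M Y) (\<lambda>j. a ^ j) h)"
proof
  interpret prob_space M by fact
  assume "\<exists>h. perturbation (prob_mass M Y) (\<lambda>j. a ^ j) h"
  then obtain h where pert: "perturbation (prob_mass M Y) (\<lambda>j. a ^ j) h" ..
  have Y: "prob_mass M Y (a ^ j) = p j" for j
  proof -
    have "{\<omega> \<in> space M. Y \<omega> = a ^ j} = {\<omega> \<in> space M. X \<omega> = j}"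
      using assms(4,5) by auto
    then show ?thesis
      using assms(3)[of j] by (simp add: prob_mass_def)
  qed
  define S where "S = {j. p j > 0}"
  have bdd: "bdd_above ((\<lambda>j. \<bar>h j\<bar>) ` S)" and sup: "(SUP j\<in>S. \<bar>h j\<bar>) = 1"
    and orth: "\<And>k. (\<lambda>j. (a ^ j) ^ k * (p j * h j)) sums 0"
    using pert by (simp_all add: perturbation_def Y S_def mult.assoc)
  have p_nonneg: "p j \<ge> 0" for j
    unfolding assms(3)[symmetric] prob_mass_def by simp
  have "norm (p j * h j) \<le> norm (p j)" for j
  proof (cases "j \<in> S")
    case True
    then have "\<bar>h j\<bar> \<le> 1"
      using cSUP_upper[OF True bdd] sup by simp
    then show ?thesis
      by (simp add: abs_mult mult_left_le)
  next
    case False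
    then show ?thesis
      using p_nonneg[of j] by (simp add: S_def)
  qed
  then have "(\<lambda>j. p j * h j) \<in> O(p)"
    by (intro landau_o.big_mono always_eventually) blast
  then have "(\<lambda>j. p j * h j) \<in> o(\<lambda>j. a powr (- (real j * (real j - 1) / 2)))"
    using assms(6) by (rule landau_o.big_small_trans)
  then have "p j * h j = 0" for j
    using zero_if_small_and_orthogonal_to_powers[OF assms(4) _ orth] by blast
  then have "\<bar>h j\<bar> = 0" if "j \<in> S" for j
    using that by (metis S_def abs_zero less_irrefl mem_Collect_eq mult_eq_0_iff)
  moreover have "S \<noteq> {}"
    using prob_mass_pos_ex[OF assms(2)] assms(3) by (auto simp: S_def)
  ultimately have "(SUP j\<in>S. \<bar>h j\<bar>) = 0"
    by simp
  then show False
    using sup by simp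
qed

end
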